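(* There exists an infinite family of graphs $G_1,G_2,\dots$ such that $A_b(G_n)-\Delta(G_n)\to\infty$ as $n\to\infty$.
   Context: $\Delta(G)$ denotes the maximum degree of $G$. A (proper) $k$-coloring of $G$ is a map $c:V(G)\to[k]$ with adjacent vertices colored differently, all $k$ colors used; $V_i=c^{-1}(i)$. A coloring is acyclic if $G[V_i\cup V_j]$ is a forest for all $i,j$. A vertex $v$ is a b-vertex if the colors on $v$ and its neighbors are all $k$ colors. A recoloring step applied to $c$ and a color $i$ having no b-vertex recolors every $v\in V_i$ with a color not appearing on $v$ or its neighbors, producing a $(k-1)$-coloring; if both colorings are acyclic it is an acyclic recoloring step. The acyclic b-chromatic number $A_b(G)$ is the maximum number of colors of an acyclic coloring of $G$ to which no acyclic recoloring step can be applied. *)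

theory Defs
  imports "Graph_Theory.Graph_Theory"
begin

text \<open>
  Finite simple graphs are modelled by the locale \<^locale>\<open>pair_graph\<close>: finite, symmetric and
  loop-free sets of arcs. An undirected edge is a pair of opposite arcs, so every edge gives a
  directed cycle of length two, and \<^const>\<open>forest\<close> (no directed cycle at all) would only accept
  edgeless graphs. The cycles of the undirected graph are exactly the directed cycles of
  length at least three.
\<close>

definition undirected_forest :: "('a, 'b) pre_digraph \<Rightarrow> bool" where
  "undirected_forest H \<longleftrightarrow> \<not> (\<exists>p. pre_digraph.cycle H p \<and> length p \<ge> 3)"

definition nbrs :: "'a pair_pre_digraph \<Rightarrow> 'a \<Rightarrow> 'a set" where
  "nbrs G v = {u. (v, u) \<in> parcs G}"

text \<open>Only meaningful for finite graphs with at least one vertex.\<close>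

definition max_degree :: "'a pair_pre_digraph \<Rightarrow> nat" where
  "max_degree G = Max (out_degree (with_proj G) ` pverts G)"

text \<open>
  A \<open>k\<close>-coloring is a coloring with color set \<open>{1..k}\<close>. The color set \<open>C\<close> is kept general because
  a recoloring step that removes color \<open>i\<close> leaves the color set \<open>C - {i}\<close>. Values of \<open>c\<close> outside
  the vertex set are irrelevant.
\<close>

definition coloring :: "'a pair_pre_digraph \<Rightarrow> nat set \<Rightarrow> ('a \<Rightarrow> nat) \<Rightarrow> bool" where
  "coloring G C c \<longleftrightarrow> c ` pverts G = C \<and> (\<forall>(u, v) \<in> parcs G. c u \<noteq> c v)"

definition color_class :: "'a pair_pre_digraph \<Rightarrow> ('a \<Rightarrow> nat) \<Rightarrow> nat \<Rightarrow> 'a set" where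
  "color_class G c i = {v \<in> pverts G. c v = i}"

definition acyclic_coloring :: "'a pair_pre_digraph \<Rightarrow> nat set \<Rightarrow> ('a \<Rightarrow> nat) \<Rightarrow> bool" where
  "acyclic_coloring G C c \<longleftrightarrow> coloring G C c \<and>
     (\<forall>i\<in>C. \<forall>j\<in>C.
        undirected_forest (with_proj G \<restriction> (color_class G c i \<union> color_class G c j)))"

definition closed_nbr_colors :: "'a pair_pre_digraph \<Rightarrow> ('a \<Rightarrow> nat) \<Rightarrow> 'a \<Rightarrow> nat set" where
  "closed_nbr_colors G c v = c ` insert v (nbrs G v)"

definition b_vertex :: "'a pair_pre_digraph \<Rightarrow> nat set \<Rightarrow> ('a \<Rightarrow> nat) \<Rightarrow> 'a \<Rightarrow> bool" where
  "b_vertex G C c v \<longleftrightarrow> v \<in> pverts G \<and> closed_nbr_colors G c v = C"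

definition recoloring_step ::
  "'a pair_pre_digraph \<Rightarrow> nat set \<Rightarrow> ('a \<Rightarrow> nat) \<Rightarrow> nat \<Rightarrow> ('a \<Rightarrow> nat) \<Rightarrow> bool" where
  "recoloring_step G C c i c' \<longleftrightarrow>
     coloring G C c \<and> i \<in> C \<and> (\<forall>v \<in> color_class G c i. \<not> b_vertex G C c v) \<and>
     (\<forall>v \<in> color_class G c i. c' v \<in> C - closed_nbr_colors G c v) \<and>
     (\<forall>v \<in> pverts G - color_class G c i. c' v = c v)"

lemma (in pair_graph) recoloring_step_coloring:
  assumes "recoloring_step G C c i c'"
  shows "coloring G (C - {i}) c'"
proof -
  have col: "c ` pverts G = C" "\<And>u v. (u, v) \<in> parcs G \<Longrightarrow> c u \<noteq> c v"
    using assms by (auto simp: recoloring_step_def coloring_def)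
  have new: "c' v \<in> C" "c' v \<noteq> i" "\<And>u. (v, u) \<in> parcs G \<Longrightarrow> c' v \<noteq> c u"
    if "v \<in> pverts G" "c v = i" for v
    using assms that
    by (auto simp: recoloring_step_def color_class_def closed_nbr_colors_def nbrs_def)
  have old: "c' v = c v" if "v \<in> pverts G" "c v \<noteq> i" for v
    using assms that by (auto simp: recoloring_step_def color_class_def)
  have sym: "(v, u) \<in> parcs G" if "(u, v) \<in> parcs G" for u v
    using that arcs_symmetric by blast
  have ends: "u \<in> pverts G" "v \<in> pverts G" if "(u, v) \<in> parcs G" for u v
    using that in_arcsD1 in_arcsD2 by blast+
  have "c' ` pverts G \<subseteq> C - {i}"
  proof
    fix x assume "x \<in> c' ` pverts G"
    then obtain v where "v \<in> pverts G" "x = c' v" by blast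
    then show "x \<in> C - {i}" using new old col by (cases "c v = i") auto
  qed
  moreover have "C - {i} \<subseteq> c' ` pverts G"
  proof
    fix x assume x: "x \<in> C - {i}"
    then obtain v where "v \<in> pverts G" "x = c v" using col by blast
    then show "x \<in> c' ` pverts G" using old x by (metis DiffD2 image_eqI singletonI)
  qed
  moreover have "c' u \<noteq> c' v" if "(u, v) \<in> parcs G" for u v
    using col(2)[OF that] new old sym[OF that] ends[OF that] that by metis
  ultimately show ?thesis by (auto simp: coloring_def)
qed

definition acyclic_recoloring_step ::
  "'a pair_pre_digraph \<Rightarrow> nat set \<Rightarrow> ('a \<Rightarrow> nat) \<Rightarrow> nat \<Rightarrow> ('a \<Rightarrow> nat) \<Rightarrow> bool" where
  "acyclic_recoloring_step G C c i c' \<longleftrightarrow>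
     recoloring_step G C c i c' \<and> acyclic_coloring G C c \<and> acyclic_coloring G (C - {i}) c'"

definition acyclic_b_chromatic_number :: "'a pair_pre_digraph \<Rightarrow> nat" where
  "acyclic_b_chromatic_number G =
     Max {k. \<exists>c. acyclic_coloring G {1..k} c \<and>
                 \<not> (\<exists>i c'. acyclic_recoloring_step G {1..k} c i c')}"

end

theory Submission
  imports Defs "HOL-Combinatorics.Transposition" "HOL-Library.Nat_Bijection"
begin

text \<open>
  Once there are more than \<open>\<Delta> + 1\<close> colors there are no b-vertices, so a color can only be protected
  by bichromatic cycles. A vertex \<open>v\<close> cannot take the color of a vertex \<open>x\<close> if \<open>v\<close> and \<open>x\<close> are
  opposite corners of a 4-cycle whose other two corners are monochromatic. Join \<open>v\<close> to two
  monochromatic pairs of hubs, and give each pair \<open>s\<close> further common neighbors: then \<open>v\<close> is blocked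
  from all \<open>2 s + 3\<close> colors, while all degrees are at most \<open>s + 4\<close>. Taking one copy of this gadget
  for each color, with the colors permuted so that \<open>v\<close> receives that color, blocks every
  recoloring step. Initially, the neighbors of a hub have distinct colors and every edge meets a
  hub, so no cycle is bichromatic.
\<close>

section \<open>Acyclic colorings\<close>

text \<open>Three consecutive arcs of a cycle of length at least three have this form. The case
  \<open>a = d\<close> is not excluded, so triangles are covered too.\<close>

lemma undirected_forestI:
  assumes "\<And>a b c d. \<lbrakk>(a, b) \<in> arcs H; (b, c) \<in> arcs H; (c, d) \<in> arcs H; a \<noteq> c; b \<noteq> d\<rbrakk> \<Longrightarrow> False"
    and "tail H = fst" and "head H = snd"
  shows "undirected_forest H"
  unfolding undirected_forest_def
proof (intro notI, elim exE conjE)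
  interpret pre_digraph H .
  fix p assume "cycle p" and len: "3 \<le> length p"
  then obtain u where walk: "awalk u p u" and dist: "distinct (tl (awalk_verts u p))"
    by (auto simp: cycle_def)
  from len obtain e1 e2 e3 r where p: "p = e1 # e2 # e3 # r"
    by (auto simp: numeral_3_eq_3 Suc_le_length_iff)
  obtain a b b' c c' d where e: "e1 = (a, b)" "e2 = (b', c)" "e3 = (c', d)"
    by (metis surj_pair)
  have cas: "cas u p u" and arcs: "set p \<subseteq> arcs H"
    using walk by (auto simp: awalk_def)
  have eqs: "u = a" "b' = b" "c' = c" and rest: "cas d r a"
    using cas by (auto simp: p e assms(2,3))
  have verts: "tl (awalk_verts u p) = b # c # awalk_verts d r"
    by (cases r) (auto simp: p e eqs assms(2,3))
  \<comment> \<open>The walk is closed, so \<open>a\<close> recurs after \<open>c\<close>, and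
    distinctness of the tail of the vertex list separates \<open>a\<close> from
    \<open>c\<close>.\<close>
  have "a = last (awalk_verts d r)"
    using rest by (induction r arbitrary: d) (auto simp: assms(2,3))
  moreover have "d \<in> set (awalk_verts d r)"
    using rest by (cases r) (auto simp: assms(2,3))
  moreover have "awalk_verts d r \<noteq> []"
    by (cases r) auto
  ultimately have "a \<noteq> c" "b \<noteq> d"
    using dist unfolding verts by (auto dest: last_in_set)
  then show False
    using assms(1)[of a b c d] arcs by (auto simp: p e eqs)
qed

text \<open>On a bichromatic path, both neighbors of an inner vertex have the same color, which
  injectivity forbids at vertices of \<open>S\<close>. Of three consecutive arcs the middle one
  meets \<open>S\<close>, so one of the two inner vertices lies in \<open>S\<close>.\<close>

lemma acyclic_coloringI:
  assumes "coloring G C c"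
    and sym: "\<And>u v. (u, v) \<in> parcs G \<Longrightarrow> (v, u) \<in> parcs G"
    and cover: "\<And>u v. (u, v) \<in> parcs G \<Longrightarrow> u \<in> S \<or> v \<in> S"
    and inj: "\<And>h. h \<in> S \<Longrightarrow> inj_on c (nbrs G h)"
  shows "acyclic_coloring G C c"
  unfolding acyclic_coloring_def
proof (intro conjI ballI assms(1))
  fix i j
  let ?H = "with_proj G \<restriction> (color_class G c i \<union> color_class G c j)"
  have proper: "c u \<noteq> c v" if "(u, v) \<in> parcs G" for u v
    using that assms(1) by (auto simp: coloring_def)
  have no_path: False
    if "b \<in> S" "(a, b) \<in> arcs ?H" "(b, d) \<in> arcs ?H" "a \<noteq> d" for a b d
  proof -
    have ab: "(a, b) \<in> parcs G" "(b, d) \<in> parcs G"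
      and col: "c a \<in> {i, j}" "c b \<in> {i, j}" "c d \<in> {i, j}"
      using that by (auto simp: color_class_def)
    have "c a = c d"
      using proper[OF ab(1)] proper[OF ab(2)] col by auto
    then show False
      using inj[OF that(1)] sym[OF ab(1)] ab(2) that(4) by (auto simp: inj_on_def nbrs_def)
  qed
  have arcD: "(a, b) \<in> parcs G" if "(a, b) \<in> arcs ?H" for a b
    using that by auto
  show "undirected_forest ?H"
    using cover no_path arcD by (intro undirected_forestI) (blast | simp)+
qed

lemma not_undirected_forest_four_cycle:
  assumes "distinct [a, b, c, d]" "{a, b, c, d} \<subseteq> verts H"
    and "{(a, b), (b, c), (c, d), (d, a)} \<subseteq> arcs H"
    and "tail H = fst" and "head H = snd"
  shows "\<not> undirected_forest H"
proof -
  interpret pre_digraph H .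
  let ?p = "[(a, b), (b, c), (c, d), (d, a)]"
  have "cycle ?p"
    using assms unfolding cycle_def awalk_def by (intro exI[of _ a]) auto
  then show ?thesis
    unfolding undirected_forest_def by (intro notI, elim notE exI[of _ ?p] conjI) auto
qed

text \<open>Whichever color \<open>j\<close> the step gives to \<open>v\<close>, the 4-cycle through
  \<open>v\<close>, \<open>u\<close>, \<open>x\<close>, \<open>w\<close> becomes bichromatic, since
  its other corners keep their colors.\<close>

lemma (in pair_graph) no_acyclic_recoloring_step:
  assumes v: "v \<in> pverts G" "c v = i"
    and blocked: "\<And>j. j \<in> C - closed_nbr_colors G c v \<Longrightarrow>
      \<exists>u w x. u \<noteq> w \<and> c u = c w \<and> c x = j \<and> (v, u) \<in> parcs G \<and> (v, w) \<in> parcs G \<and>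
        (x, u) \<in> parcs G \<and> (x, w) \<in> parcs G"
  shows "\<not> acyclic_recoloring_step G C c i c'"
proof
  assume "acyclic_recoloring_step G C c i c'"
  then have step: "recoloring_step G C c i c'" and ac: "acyclic_coloring G (C - {i}) c'"
    by (auto simp: acyclic_recoloring_step_def)
  have new: "c' v \<in> C - closed_nbr_colors G c v"
    using step v by (auto simp: recoloring_step_def color_class_def)
  have old: "c' y = c y" if "y \<in> pverts G" "c y \<noteq> i" for y
    using step that by (auto simp: recoloring_step_def color_class_def)
  have proper: "c y \<noteq> c z" if "(y, z) \<in> parcs G" for y z
    using step that by (auto simp: recoloring_step_def coloring_def)
  obtain u w x where uwx: "u \<noteq> w" "c u = c w" "c x = c' v" and
    arcs: "(v, u) \<in> parcs G" "(v, w) \<in> parcs G" "(x, u) \<in> parcs G" "(x, w) \<in> parcs G"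
    using blocked[OF new] by blast
  have rev: "(u, v) \<in> parcs G" "(w, v) \<in> parcs G" "(u, x) \<in> parcs G" "(w, x) \<in> parcs G"
    using arcs arcs_symmetric by blast+
  have mem: "u \<in> pverts G" "w \<in> pverts G" "x \<in> pverts G"
    using arcs in_arcsD1 in_arcsD2 by blast+
  \<comment> \<open>\<open>u\<close> and \<open>w\<close> are adjacent to \<open>v\<close>, and the
    color of \<open>x\<close> is one that \<open>v\<close> lacked.\<close>
  have ne: "c u \<noteq> i" "c w \<noteq> i" "c x \<noteq> i"
    using proper[OF arcs(1)] proper[OF arcs(2)] new v uwx
    by (auto simp: closed_nbr_colors_def)
  have c': "c' u = c u" "c' w = c u" "c' x = c' v"
    using old mem ne uwx by auto
  have "c' u \<in> C - {i}" "c' v \<in> C - {i}"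
    using ac v mem by (auto simp: acyclic_coloring_def coloring_def)
  then have "undirected_forest (with_proj G \<restriction> (color_class G c' (c' u) \<union> color_class G c' (c' v)))"
    using ac by (auto simp: acyclic_coloring_def)
  moreover have "distinct [v, u, x, w]"
    using uwx v ne proper[OF arcs(3)] proper[OF arcs(4)] by auto
  then have "\<not> undirected_forest (with_proj G \<restriction> (color_class G c' (c' u) \<union> color_class G c' (c' v)))"
    using arcs rev mem v c'
    by (intro not_undirected_forest_four_cycle) (auto simp: color_class_def)
  ultimately show False by contradiction
qed

section \<open>Bounds on the two graph parameters\<close>

lemma le_acyclic_b_chromatic_number:
  assumes "finite (pverts G)" "acyclic_coloring G {1..k} c"
    and "\<And>i c'. \<not> acyclic_recoloring_step G {1..k} c i c'"
  shows "k \<le> acyclic_b_chromatic_number G"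
  unfolding acyclic_b_chromatic_number_def
proof (rule Max_ge)
  \<comment> \<open>\<open>Max\<close> needs a finite set. A coloring is onto its colors, so their
    number is at most that of the vertices.\<close>
  have "k \<le> card (pverts G)" if "acyclic_coloring G {1..k} c" for k c
  proof -
    have "card (c ` pverts G) = k"
      using that by (simp add: acyclic_coloring_def coloring_def)
    then show ?thesis
      using card_image_le[OF assms(1), of c] by simp
  qed
  then show "finite {k. \<exists>c. acyclic_coloring G {1..k} c \<and>
      \<not> (\<exists>i c'. acyclic_recoloring_step G {1..k} c i c')}"
    by (intro finite_subset[OF _ finite_atMost[of "card (pverts G)"]]) auto
qed (use assms in blast)

lemma (in pair_graph) max_degree_le:
  assumes "pverts G \<noteq> {}" "\<And>v. v \<in> pverts G \<Longrightarrow> card (nbrs G v) \<le> d"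
  shows "max_degree G \<le> d"
proof -
  have "out_degree (with_proj G) v = card (nbrs G v)" for v
  proof -
    have "out_arcs (with_proj G) v = Pair v ` nbrs G v"
      by (auto simp: out_arcs_def nbrs_def)
    then show ?thesis
      by (simp add: out_degree_def card_image inj_on_def)
  qed
  then show ?thesis
    using assms by (auto simp: max_degree_def)
qed

section \<open>The construction\<close>

text \<open>
  In the gadget, \<open>0\<close> is the vertex to be blocked, \<open>{1, 2}\<close> and \<open>{3, 4}\<close> are the pairs of hubs, and
  the remaining vertices \<open>5, \<dots>, 2 s + 4\<close> are the common neighbors of the first and second pair.
\<close>

definition hub_arcs :: "nat \<Rightarrow> (nat \<times> nat) set" where
  "hub_arcs s = {1, 2} \<times> insert 0 {5..<s + 5} \<union> {3, 4} \<times> insert 0 {s + 5..<2 * s + 5}"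

definition gadget_arcs :: "nat \<Rightarrow> (nat \<times> nat) set" where
  "gadget_arcs s = hub_arcs s \<union> (hub_arcs s)\<inverse>"

text \<open>The offset 2 gives the vertices \<open>5, ..., 2 * s + 4\<close> the colors
  \<open>3, ..., 2 * s + 2\<close>, one each, so only the two partners in a hub pair share a
  color.\<close>

definition gadget_color :: "nat \<Rightarrow> nat" where
  "gadget_color q = (if q = 0 then 0 else if q \<le> 2 then 1 else if q \<le> 4 then 2 else q - 2)"

text \<open>Pairs of a copy and a gadget vertex are encoded as natural numbers, so that the graphs
  for all \<open>s\<close> have the same vertex type.\<close>

definition gadgets :: "nat \<Rightarrow> nat pair_pre_digraph" where
  "gadgets s = \<lparr>pverts = prod_encode ` ({..<2 * s + 3} \<times> {..<2 * s + 5}),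
     parcs = {(prod_encode (g, p), prod_encode (g, q)) | g p q.
       g < 2 * s + 3 \<and> (p, q) \<in> gadget_arcs s}\<rparr>"

text \<open>The transposition of colors \<open>0\<close> and \<open>g\<close> is applied in copy \<open>g\<close>; colors start at \<open>1\<close>.\<close>

definition gadgets_color :: "nat \<Rightarrow> nat" where
  "gadgets_color v = (case prod_decode v of (g, q) \<Rightarrow> Suc (transpose 0 g (gadget_color q)))"

section \<open>The single gadget\<close>

lemma gadget_arcs_less:
  "(p, q) \<in> gadget_arcs s \<Longrightarrow> p < 2 * s + 5 \<and> q < 2 * s + 5"
  by (auto simp: gadget_arcs_def hub_arcs_def)

lemma gadget_color_proper:
  "(p, q) \<in> gadget_arcs s \<Longrightarrow> gadget_color p \<noteq> gadget_color q"
  by (auto simp: gadget_arcs_def hub_arcs_def gadget_color_def)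

lemma gadget_color_less: "q < 2 * s + 5 \<Longrightarrow> gadget_color q < 2 * s + 3"
  by (auto simp: gadget_color_def)

text \<open>Neighbors of a hub are not hubs, and non-hubs have pairwise distinct colors.\<close>

lemma inj_on_gadget_color: "p \<in> {1..4} \<Longrightarrow> inj_on gadget_color {q. (p, q) \<in> gadget_arcs s}"
  by (auto simp: gadget_arcs_def hub_arcs_def gadget_color_def inj_on_def split: if_splits)

lemma gadget_arcs_cover: "(p, q) \<in> gadget_arcs s \<Longrightarrow> p \<in> {1..4} \<or> q \<in> {1..4}"
  by (auto simp: gadget_arcs_def hub_arcs_def)

text \<open>A hub has \<open>0\<close> and the \<open>s\<close> common neighbors of its pair; any
  other vertex is adjacent only to hubs, of which there are four. The sum is a crude bound for both
  cases.\<close>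

lemma card_gadget_nbrs: "card {q. (p, q) \<in> gadget_arcs s} \<le> s + 4"
proof -
  have "\<exists>A B. {q. (p, q) \<in> gadget_arcs s} \<subseteq> A \<union> B \<and> finite (A \<union> B) \<and> card A \<le> s \<and> card B \<le> 4"
  proof (cases "p \<in> {1..4}")
    case True
    then show ?thesis
      by (intro exI[of _ "if p \<le> 2 then {5..<s + 5} else {s + 5..<2 * s + 5}"] exI[of _ "{0}"])
         (auto simp: gadget_arcs_def hub_arcs_def)
  next
    case False
    then show ?thesis
      by (intro exI[of _ "{}"] exI[of _ "{1..4}"]) (auto simp: gadget_arcs_def hub_arcs_def)
  qed
  then obtain A B where "{q. (p, q) \<in> gadget_arcs s} \<subseteq> A \<union> B" "finite (A \<union> B)"
      "card A \<le> s" "card B \<le> 4"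
    by blast
  then show ?thesis
    using card_mono[of "A \<union> B"] card_Un_le[of A B] by (meson add_mono le_trans)
qed

section \<open>The disjoint union of the copies\<close>

lemma gadgets_color_encode [simp]:
  "gadgets_color (prod_encode (g, q)) = Suc (transpose 0 g (gadget_color q))"
  by (simp add: gadgets_color_def)

text \<open>A transposition is injective. This carries properness and injectivity at hubs from the
  gadget to each copy.\<close>

lemma gadgets_color_eq_iff:
  "gadgets_color (prod_encode (g, p)) = gadgets_color (prod_encode (g, q)) \<longleftrightarrow>
     gadget_color p = gadget_color q"
  by (metis Suc_inject gadgets_color_encode transpose_involutory)

lemma gadgets_arc_iff [simp]:
  "(prod_encode (g, p), prod_encode (g', q)) \<in> parcs (gadgets s) \<longleftrightarrow>
     g' = g \<and> g < 2 * s + 3 \<and> (p, q) \<in> gadget_arcs s"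
  by (auto simp: gadgets_def)

lemma gadgets_arcE:
  assumes "(u, v) \<in> parcs (gadgets s)"
  obtains g p q where "u = prod_encode (g, p)" "v = prod_encode (g, q)"
    "g < 2 * s + 3" "(p, q) \<in> gadget_arcs s"
  using assms by (auto simp: gadgets_def)

lemma gadgets_vert_iff [simp]:
  "prod_encode (g, q) \<in> pverts (gadgets s) \<longleftrightarrow> g < 2 * s + 3 \<and> q < 2 * s + 5"
  by (auto simp: gadgets_def)

lemma gadgets_vertE:
  assumes "v \<in> pverts (gadgets s)"
  obtains g q where "v = prod_encode (g, q)" "g < 2 * s + 3" "q < 2 * s + 5"
  using assms by (auto simp: gadgets_def)

lemma gadgets_nonempty: "pverts (gadgets s) \<noteq> {}"
  using gadgets_vert_iff[of 0 0 s] by fastforce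

lemma nbrs_gadgets:
  "g < 2 * s + 3 \<Longrightarrow>
     nbrs (gadgets s) (prod_encode (g, p)) = (\<lambda>q. prod_encode (g, q)) ` {q. (p, q) \<in> gadget_arcs s}"
  by (auto simp: nbrs_def elim!: gadgets_arcE)

lemma gadgets_sym: "(u, v) \<in> parcs (gadgets s) \<Longrightarrow> (v, u) \<in> parcs (gadgets s)"
  by (elim gadgets_arcE) (auto simp: gadget_arcs_def)

lemma pair_graph_gadgets: "pair_graph (gadgets s)"
proof
  show "finite (pverts (gadgets s))"
    by (simp add: gadgets_def)
  moreover have ends: "u \<in> pverts (gadgets s) \<and> v \<in> pverts (gadgets s)"
    if "(u, v) \<in> parcs (gadgets s)" for u v
    using that by (elim gadgets_arcE) (auto dest: gadget_arcs_less)
  ultimately show "finite (parcs (gadgets s))"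
    by (intro finite_subset[of "parcs (gadgets s)" "pverts (gadgets s) \<times> pverts (gadgets s)"]) auto
  show "fst e \<in> pverts (gadgets s)" "snd e \<in> pverts (gadgets s)" if "e \<in> parcs (gadgets s)" for e
    using that ends by (metis prod.collapse)+
  show "fst e \<noteq> snd e" if "e \<in> parcs (gadgets s)" for e
    using that by (cases e) (auto elim!: gadgets_arcE dest: gadget_color_proper)
  show "symmetric (with_proj (gadgets s))"
    using gadgets_sym by (auto simp: symmetric_def sym_def arcs_ends_def arc_to_ends_def)
qed

lemma gadgets_color_in:
  assumes "v \<in> pverts (gadgets s)"
  shows "gadgets_color v \<in> {1..2 * s + 3}"
  using assms gadget_color_less[of _ s]
  by (elim gadgets_vertE) (fastforce simp: transpose_def)

lemma coloring_gadgets: "coloring (gadgets s) {1..2 * s + 3} gadgets_color"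
  unfolding coloring_def
proof (intro conjI ballI subset_antisym subsetI)
  fix i assume i: "i \<in> {1..2 * s + 3}"
  show "i \<in> gadgets_color ` pverts (gadgets s)"
  proof (rule image_eqI)
    \<comment> \<open>In copy \<open>i - 1\<close> the transposition sends the color
      \<open>0\<close> of vertex \<open>0\<close> to \<open>i - 1\<close>.\<close>
    show "i = gadgets_color (prod_encode (i - 1, 0))"
      using i by (simp add: gadget_color_def)
    show "prod_encode (i - 1, 0) \<in> pverts (gadgets s)"
      using i by auto
  qed
next
  fix e assume "e \<in> parcs (gadgets s)"
  then show "case e of (u, v) \<Rightarrow> gadgets_color u \<noteq> gadgets_color v"
    by (cases e) (auto simp del: gadgets_color_encode elim!: gadgets_arcE
        simp: gadgets_color_eq_iff dest: gadget_color_proper)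
qed (use gadgets_color_in in blast)

lemma acyclic_coloring_gadgets: "acyclic_coloring (gadgets s) {1..2 * s + 3} gadgets_color"
proof (rule acyclic_coloringI[OF coloring_gadgets gadgets_sym])
  let ?S = "prod_encode ` ({..<2 * s + 3} \<times> {1..4})"
  show "u \<in> ?S \<or> v \<in> ?S" if "(u, v) \<in> parcs (gadgets s)" for u v
    using that by (elim gadgets_arcE) (use gadget_arcs_cover in fastforce)
  fix h assume "h \<in> ?S"
  then obtain g p where h: "h = prod_encode (g, p)" "g < 2 * s + 3" "p \<in> {1..4}"
    by auto
  show "inj_on gadgets_color (nbrs (gadgets s) h)"
    using inj_on_gadget_color[OF h(3), of s]
    by (auto simp: h(1) nbrs_gadgets[OF h(2)] inj_on_def gadgets_color_eq_iff
        simp del: gadgets_color_encode)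
qed

text \<open>The vertex \<open>0\<close> of copy \<open>i - 1\<close> has color \<open>i\<close> and
  cannot take any other color.\<close>

lemma no_acyclic_recoloring_step_gadgets:
  "\<not> acyclic_recoloring_step (gadgets s) {1..2 * s + 3} gadgets_color i c'"
proof (cases "i \<in> {1..2 * s + 3}")
  case False
  then show ?thesis
    by (auto simp: acyclic_recoloring_step_def recoloring_step_def)
next
  case True
  define g where "g = i - 1"
  have g: "g < 2 * s + 3" "i = Suc g"
    using True by (auto simp: g_def)
  let ?v = "prod_encode (g, 0)"
  show ?thesis
  proof (rule pair_graph.no_acyclic_recoloring_step[OF pair_graph_gadgets])
    show "?v \<in> pverts (gadgets s)" "gadgets_color ?v = i"
      using g by (auto simp: gadget_color_def)
    fix j assume j: "j \<in> {1..2 * s + 3} - closed_nbr_colors (gadgets s) gadgets_color ?v"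
    \<comment> \<open>The transposition is its own inverse, so \<open>m\<close> is the gadget color
      that becomes \<open>j\<close> in this copy.\<close>
    define m where "m = transpose 0 g (j - 1)"
    have m: "j = Suc (transpose 0 g m)" "m < 2 * s + 3"
      using j g by (auto simp: m_def transpose_def)
    have "j \<noteq> gadgets_color (prod_encode (g, q))" if "q \<in> {0, 1, 3}" for q
    proof -
      have "prod_encode (g, q) \<in> insert ?v (nbrs (gadgets s) ?v)"
        using that g by (auto simp: nbrs_def gadget_arcs_def hub_arcs_def)
      then show ?thesis
        using j unfolding closed_nbr_colors_def by blast
    qed
    \<comment> \<open>Gadget colors \<open>0\<close>, \<open>1\<close>, \<open>2\<close> occur on
      \<open>?v\<close> and its neighbors, so \<open>m\<close> is the color of a common neighbor of
      some hub pair.\<close>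
    then have "m \<noteq> gadget_color q" if "q \<in> {0, 1, 3}" for q
      using that m(1) by auto
    from this[of 0] this[of 1] this[of 3] have "m \<ge> 3"
      by (simp add: gadget_color_def)
    \<comment> \<open>The vertex of gadget color \<open>m\<close> is \<open>m + 2\<close>; it is
      joined to the first pair iff \<open>m + 2 < s + 5\<close>. The pair in question is
      \<open>h\<close>, \<open>Suc h\<close>.\<close>
    define h :: nat where "h = (if m < s + 3 then 1 else 3)"
    show "\<exists>u w x. u \<noteq> w \<and> gadgets_color u = gadgets_color w \<and> gadgets_color x = j \<and>
        (?v, u) \<in> parcs (gadgets s) \<and> (?v, w) \<in> parcs (gadgets s) \<and>
        (x, u) \<in> parcs (gadgets s) \<and> (x, w) \<in> parcs (gadgets s)"
      using g m \<open>m \<ge> 3\<close>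
      by (intro exI[of _ "prod_encode (g, h)"] exI[of _ "prod_encode (g, Suc h)"]
          exI[of _ "prod_encode (g, m + 2)"])
        (auto simp: h_def gadget_color_def gadget_arcs_def hub_arcs_def)
  qed
qed

lemma max_degree_gadgets: "max_degree (gadgets s) \<le> s + 4"
proof (rule pair_graph.max_degree_le[OF pair_graph_gadgets gadgets_nonempty])
  fix v assume "v \<in> pverts (gadgets s)"
  then show "card (nbrs (gadgets s) v) \<le> s + 4"
    using card_gadget_nbrs[of _ s]
    by (elim gadgets_vertE) (simp add: nbrs_gadgets card_image inj_on_def)
qed

theorem theorem3:
  shows "\<exists>G :: nat \<Rightarrow> nat pair_pre_digraph.
    (\<forall>n. pair_graph (G n) \<and> pverts (G n) \<noteq> {}) \<and>
    filterlim (\<lambda>n. int (acyclic_b_chromatic_number (G n)) - int (max_degree (G n)))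
      at_top sequentially"
proof (intro exI[of _ gadgets] conjI allI pair_graph_gadgets gadgets_nonempty)
  \<comment> \<open>The gap is at least \<open>(2 * n + 3) - (n + 4)\<close>.\<close>
  have "int n - 1 \<le> int (acyclic_b_chromatic_number (gadgets n)) - int (max_degree (gadgets n))" for n
  proof -
    have "2 * n + 3 \<le> acyclic_b_chromatic_number (gadgets n)"
      by (rule le_acyclic_b_chromatic_number[OF _ acyclic_coloring_gadgets
            no_acyclic_recoloring_step_gadgets]) (simp add: gadgets_def)
    then show ?thesis
      using max_degree_gadgets[of n] by linarith
  qed
  moreover have "filterlim (\<lambda>n. int n - 1) at_top sequentially"
    unfolding filterlim_at_top eventually_sequentially
    by (metis add.commute le_diff_eq le_nat_iff nat_le_iff)
  ultimately show "filterlim (\<lambda>n. int (acyclic_b_chromatic_number (gadgets n)) -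
      int (max_degree (gadgets n))) at_top sequentially"
    by (auto intro: filterlim_at_top_mono)
qed

end
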